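(* In the Chow–Robbins game, in the position with 5 heads and 3 tails (that is, 5 heads out of 8 coin flips), stopping is optimal. Equivalently, $V(5,8)=\frac58$.
   Context: The Chow–Robbins game: a fair coin is tossed repeatedly (independent tosses, each heads with probability $1/2$), and the player may stop whenever he wants, based on the outcomes seen so far. The payoff is the proportion of heads among all tosses up to the moment of stopping, and the player wants to maximize the expected payoff. A position $(a,n)$, with integers $n\ge 1$ and $0\le a\le n$, means that $a$ heads have occurred in the first $n$ coin flips. $V(a,n)$ denotes the expected payoff under optimal play from position $(a,n)$, i.e. $$V(a,n)=\sup_{\tau}\ \mathbb{E}\left[\frac{a+S_\tau}{n+\tau}\right],$$ where $S_m=X_1+\dots+X_m$ ($S_0=0$), $X_1,X_2,\dots$ are i.i.d. with $\Pr(X_i=1)=\Pr(X_i=0)=1/2$ (the future flips, $1$ = heads), and the supremum is over all almost surely finite stopping times $\tau\ge 0$ with respect to the filtration generated by $X_1,X_2,\dots$. Stopping immediately in position $(a,n)$ gives payoff $a/n$; stopping is optimal in position $(a,n)$ precisely when $V(a,n)=a/n$, while continuing is better precisely when $V(a,n)>a/n$. *)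

theory Defs
  imports "HOL-Probability.Probability"
begin

text \<open>
  Flips are indexed from 0: \<open>X i\<close> is the \<open>(i+1)\<close>-st future flip, with value 1 for heads
  and 0 for tails. The underlying probability space is arbitrary.
\<close>

locale fair_coin_flips = prob_space M
  for M :: "'a measure" +
  fixes X :: "nat \<Rightarrow> 'a \<Rightarrow> real"
  assumes indep_flips: "indep_vars (\<lambda>_. borel) X UNIV"
    and prob_heads: "\<And>i. prob {\<omega> \<in> space M. X i \<omega> = 1} = 1 / 2"
    and prob_tails: "\<And>i. prob {\<omega> \<in> space M. X i \<omega> = 0} = 1 / 2"

definition heads_count :: "(nat \<Rightarrow> 'a \<Rightarrow> real) \<Rightarrow> nat \<Rightarrow> 'a \<Rightarrow> real" where
  "heads_count X m \<omega> = (\<Sum>i<m. X i \<omega>)"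

text \<open>
  The filtration generated by the flips; at time \<open>t\<close> the flips \<open>X 0, \<dots>, X (t - 1)\<close> have been
  observed. Time is extended by \<open>\<infinity>\<close> because an almost surely finite stopping time may take
  the value \<open>\<infinity>\<close> on a null set.
\<close>

definition flip_filtration :: "'a measure \<Rightarrow> (nat \<Rightarrow> 'a \<Rightarrow> real) \<Rightarrow> enat \<Rightarrow> 'a measure" where
  "flip_filtration M X t =
     sigma (space M) {X i -` B \<inter> space M | i B. enat i < t \<and> B \<in> sets borel}"

definition stopping_rules :: "'a measure \<Rightarrow> (nat \<Rightarrow> 'a \<Rightarrow> real) \<Rightarrow> ('a \<Rightarrow> enat) set" where
  "stopping_rules M X =
     {T. stopping_time (flip_filtration M X) T \<and> (AE \<omega> in M. T \<omega> \<noteq> \<infinity>)}"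

definition payoff :: "(nat \<Rightarrow> 'a \<Rightarrow> real) \<Rightarrow> nat \<Rightarrow> nat \<Rightarrow> ('a \<Rightarrow> enat) \<Rightarrow> 'a \<Rightarrow> real" where
  "payoff X a n T \<omega> =
     (real a + heads_count X (the_enat (T \<omega>)) \<omega>) / (real n + real (the_enat (T \<omega>)))"

text \<open>
  For \<open>1 \<le> n\<close> and \<open>a \<le> n\<close> the payoffs lie in \<open>[0, 1]\<close> almost surely and \<open>T = 0\<close> is a stopping
  rule, so the supremum is over a nonempty bounded set of reals.
\<close>

definition game_value :: "'a measure \<Rightarrow> (nat \<Rightarrow> 'a \<Rightarrow> real) \<Rightarrow> nat \<Rightarrow> nat \<Rightarrow> real" where
  "game_value M X a n = (SUP T \<in> stopping_rules M X. \<integral>\<omega>. payoff X a n T \<omega> \<partial>M)"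

definition stopping_optimal :: "'a measure \<Rightarrow> (nat \<Rightarrow> 'a \<Rightarrow> real) \<Rightarrow> nat \<Rightarrow> nat \<Rightarrow> bool" where
  "stopping_optimal M X a n \<longleftrightarrow> game_value M X a n = real a / real n"

end

theory Submission
  imports Defs
begin

text \<open>
  Positions are written as (heads, tails). A function that dominates the payoff and is at least
  the average of its two successors bounds the game value, by optional stopping. Such a function
  valid from toss 18 on is \<open>1/2 + 5/32 * mills a b\<close>, where \<open>mills\<close> is the discrete analogue of
  Shepp's solution for Brownian motion, a harmonic mixture of exponential martingales. With its
  translates as bounds at toss 20, backward induction down to 5 heads and 3 tails gives 5/8.
\<close>

section \<open>Excessive majorants\<close>

text \<open>The quadrant \<open>x \<ge> a\<close>, \<open>y \<ge> b\<close> consists of the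
  positions reachable from \<open>(a, b)\<close>.\<close>

definition majorant_from :: "nat \<Rightarrow> nat \<Rightarrow> (nat \<Rightarrow> nat \<Rightarrow> real) \<Rightarrow> bool" where
  "majorant_from a b F \<longleftrightarrow>
     (\<forall>x\<ge>a. \<forall>y\<ge>b. real x / real (x + y) \<le> F x y \<and> (F (Suc x) y + F x (Suc y)) / 2 \<le> F x y)"

text \<open>The majorant is existential so that bounds at different positions, each with a majorant
  of its own, can be combined.\<close>

definition majorized :: "nat \<Rightarrow> nat \<Rightarrow> real \<Rightarrow> bool" where
  "majorized a b v \<longleftrightarrow> (\<exists>F. majorant_from a b F \<and> F a b \<le> v)"

lemma majorant_fromD:
  assumes "majorant_from a b F" "a \<le> x" "b \<le> y"
  shows "real x / real (x + y) \<le> F x y" "F (Suc x) y + F x (Suc y) \<le> 2 * F x y" "0 \<le> F x y"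
proof -
  show "real x / real (x + y) \<le> F x y" "F (Suc x) y + F x (Suc y) \<le> 2 * F x y"
    using assms by (auto simp: majorant_from_def field_simps)
  then show "0 \<le> F x y"
    by (meson divide_nonneg_nonneg of_nat_0_le_iff order_trans)
qed

text \<open>A minimum of excessive functions is excessive, so majorants on the two successor
  quadrants glue together; only \<open>(a, b)\<close> itself needs a new value.\<close>

lemma majorized_step:
  assumes heads: "majorized (Suc a) b v1" and tails: "majorized a (Suc b) v2"
    and stop: "real a / real (a + b) \<le> v" and continue: "(v1 + v2) / 2 \<le> v"
  shows "majorized a b v"
proof -
  obtain F where F: "majorant_from (Suc a) b F" "F (Suc a) b \<le> v1"
    using heads by (auto simp: majorized_def)
  obtain G where G: "majorant_from a (Suc b) G" "G a (Suc b) \<le> v2"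
    using tails by (auto simp: majorized_def)
  \<comment> \<open>Each edge lies in only one successor quadrant. A move from an edge into the
    interior meets the minimum, which is at most the function used on that edge.\<close>
  define H where "H x y =
    (if x = a then if y = b then v else G x y
     else if y = b then F x y else min (F x y) (G x y))" for x y
  have "real x / real (x + y) \<le> H x y \<and> (H (Suc x) y + H x (Suc y)) / 2 \<le> H x y"
    if xy: "x \<ge> a" "y \<ge> b" for x y
  proof (cases "x = a"; cases "y = b")
    assume "x = a" "y = b"
    then show ?thesis using stop continue F(2) G(2) by (simp add: H_def)
  next
    assume c: "x = a" "y \<noteq> b"
    then show ?thesis using majorant_fromD[OF G(1), of x y] xy by (auto simp: H_def)
  next
    assume c: "x \<noteq> a" "y = b"
    then show ?thesis using majorant_fromD[OF F(1), of x y] xy by (auto simp: H_def)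
  next
    assume c: "x \<noteq> a" "y \<noteq> b"
    then show ?thesis
      using majorant_fromD[OF F(1), of x y] majorant_fromD[OF G(1), of x y] xy
      by (auto simp: H_def min_def)
  qed
  then have "majorant_from a b H" by (simp add: majorant_from_def)
  moreover have "H a b \<le> v" by (simp add: H_def)
  ultimately show ?thesis by (auto simp: majorized_def)
qed

section \<open>A harmonic function\<close>

text \<open>
  For \<open>a, b \<ge> 1\<close> and \<open>n = a + b\<close> this is the incomplete beta integral
  \<open>2 ^ (n - 1) * (\<integral>p\<in>{1/2..1}. p ^ (a - 1) * (1 - p) ^ (b - 1))\<close>, a mixture of the harmonic
  functions \<open>p ^ a * (1 - p) ^ b * 2 ^ n\<close>; the recursion is integration by parts.
\<close>

fun mills :: "nat \<Rightarrow> nat \<Rightarrow> real" where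
  "mills 0 b = 0"
| "mills (Suc a) b = (real a * mills a (Suc b) + 1) / real b"

lemma mills_nonneg: "0 \<le> mills a b"
  by (induction a b rule: mills.induct) auto

lemma mills_Suc: "0 < b \<Longrightarrow> real b * mills (Suc a) b = real a * mills a (Suc b) + 1"
  by simp

declare mills.simps(2) [simp del]

lemma mills_harmonic:
  assumes "0 < a" "0 < b"
  shows "mills (Suc a) b + mills a (Suc b) = 2 * mills a b"
  using assms
proof (induction a arbitrary: b)
  case (Suc a)
  have IH: "real a * (mills (Suc a) (Suc b) + mills a (Suc (Suc b))) = real a * (2 * mills a (Suc b))"
    using Suc.IH[of "Suc b"] by (cases "a = 0") auto
  have e1: "real b * mills (Suc (Suc a)) b = real (Suc a) * mills (Suc a) (Suc b) + 1"
    using mills_Suc Suc.prems by blast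
  have e2: "real (Suc b) * mills (Suc a) (Suc b) = real a * mills a (Suc (Suc b)) + 1"
    by (rule mills_Suc) simp
  have e3: "real b * mills (Suc a) b = real a * mills a (Suc b) + 1"
    using mills_Suc Suc.prems by blast
  have "real b * (mills (Suc (Suc a)) b + mills (Suc a) (Suc b)) = real b * (2 * mills (Suc a) b)"
    using IH e1 e2 e3 by (simp add: algebra_simps)
  then show ?case using Suc.prems by simp
qed simp

text \<open>Harmonicity at \<open>(m, m)\<close> and \<open>(m, m + 1)\<close> lets the recursion
  eliminate the off-diagonal values.\<close>

lemma mills_diag_Suc:
  assumes "0 < m"
  shows "real (2 * m + 1) * mills (Suc m) (Suc m) = real (2 * m) * mills m m"
proof -
  have 1: "real m * mills (Suc m) m = real m * mills m (Suc m) + 1"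
    using mills_Suc assms by blast
  have 2: "mills (Suc m) m + mills m (Suc m) = 2 * mills m m"
    using mills_harmonic assms by blast
  have 3: "mills (Suc m) (Suc m) + mills m (Suc (Suc m)) = 2 * mills m (Suc m)"
    using mills_harmonic assms by blast
  have 4: "real (Suc m) * mills (Suc m) (Suc m) = real m * mills m (Suc (Suc m)) + 1"
    by (rule mills_Suc) simp
  have "2 * real m * mills m (Suc m) = 2 * real m * mills m m - 1"
    using 1 arg_cong[OF 2, of "\<lambda>x. real m * x"] by (simp add: algebra_simps)
  moreover have "real m * mills m (Suc (Suc m)) = real m * (2 * mills m (Suc m) - mills (Suc m) (Suc m))"
    using 3 by simp
  ultimately show ?thesis using 4 by (simp add: algebra_simps)
qed

text \<open>
  By Wallis' product the right-hand side increases to \<open>\<pi> / 2 = 1.5708...\<close>; it first exceeds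
  \<open>1.57\<close> at \<open>m = 9\<close>.
\<close>

lemma mills_diag_lower:
  assumes "9 \<le> m"
  shows "157 / 100 \<le> (real (2 * m) - 1 / 2) * (mills m m)\<^sup>2"
  using assms
proof (induction m rule: dec_induct)
  case base
  have "mills (Suc 0) (Suc 0) = 1" by (simp add: mills.simps)
  then have eq: "mills 9 9 = 2/3 * (4/5) * (6/7) * (8/9) * (10/11) * (12/13) * (14/15) * (16/17)"
    using mills_diag_Suc[of 1] mills_diag_Suc[of 2] mills_diag_Suc[of 3] mills_diag_Suc[of 4]
      mills_diag_Suc[of 5] mills_diag_Suc[of 6] mills_diag_Suc[of 7] mills_diag_Suc[of 8]
    by (simp add: eval_nat_numeral)
  show ?case unfolding eq by (simp add: power2_eq_square)
next
  case (step m)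
  define x where "x = real m"
  have x: "x \<ge> 9" using step.hyps by (simp add: x_def)
  have r: "mills (Suc m) (Suc m) = 2 * x / (2 * x + 1) * mills m m"
    using mills_diag_Suc[of m] step.hyps by (simp add: x_def field_simps)
  \<comment> \<open>After clearing denominators the two sides differ by exactly
    \<open>1 / 2\<close>; the shift in \<open>2 * m - 1 / 2\<close> is what makes the sequence
    increase.\<close>
  have "(2 * x - 1 / 2) \<le> (2 * x + 3 / 2) * (2 * x / (2 * x + 1))\<^sup>2"
    using x by (simp add: divide_simps power2_eq_square) (simp add: algebra_simps)
  then have "(2 * x - 1 / 2) * (mills m m)\<^sup>2
      \<le> (2 * x + 3 / 2) * (2 * x / (2 * x + 1))\<^sup>2 * (mills m m)\<^sup>2"
    by (rule mult_right_mono) simp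
  also have "\<dots> = (real (2 * Suc m) - 1 / 2) * (mills (Suc m) (Suc m))\<^sup>2"
    unfolding r by (simp add: x_def power_mult_distrib power_divide algebra_simps)
  finally show ?case using step.IH by (simp add: x_def)
qed

section \<open>Domination of the payoff\<close>

text \<open>
  With \<open>n = a + b\<close>, \<open>s = a - b\<close> and \<open>y = s / sqrt n\<close> this is \<open>1 / sqrt n\<close> times the Taylor
  polynomial of degree 3 of the continuous limit \<open>\<integral>x\<in>{0..}. exp (x * y - x\<^sup>2 / 2)\<close>, with its constant
  \<open>sqrt (\<pi> / 2)\<close> rounded down.
\<close>

definition mills_minorant :: "real \<Rightarrow> real \<Rightarrow> real" where
  "mills_minorant n s = sqrt (157 / 100) / sqrt n * (1 + s\<^sup>2 / (2 * n)) + s / n + s ^ 3 / (3 * n\<^sup>2)"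

lemma mills_diag_ge:
  assumes "9 \<le> m"
  shows "sqrt (157 / 100) / sqrt (real (2 * m)) \<le> mills m m"
proof -
  have "157 / 100 \<le> real (2 * m) * (mills m m)\<^sup>2"
    using mills_diag_lower[OF assms] by (rule order_trans) (intro mult_right_mono; simp)
  then have "157 / 100 / real (2 * m) \<le> (mills m m)\<^sup>2"
    using assms by (simp add: field_simps)
  then have "sqrt (157 / 100 / real (2 * m)) \<le> mills m m"
    using mills_nonneg by (metis real_le_lsqrt real_sqrt_le_mono real_sqrt_abs abs_of_nonneg)
  then show ?thesis by (simp only: real_sqrt_divide)
qed

text \<open>Exactly, \<open>mills (m + 1) m = mills m m + 1 / (2 * m)\<close>. The even terms of the
  minorant are compared with \<open>mills m m\<close>, the odd ones with
  \<open>1 / (2 * m)\<close>.\<close>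

lemma mills_near_diag_ge:
  assumes "9 \<le> m"
  shows "mills_minorant (real (2 * m + 1)) 1 \<le> mills (Suc m) m"
proof -
  define x where "x = real (2 * m)"
  have x: "x > 0" using assms by (simp add: x_def)
  have 1: "real m * mills (Suc m) m = real m * mills m (Suc m) + 1"
    using mills_Suc assms by simp
  have 2: "mills (Suc m) m + mills m (Suc m) = 2 * mills m m"
    using mills_harmonic assms by simp
  have "real m * mills (Suc m) m = real m * (mills m m + 1 / x)"
    using 1 arg_cong[OF 2, of "\<lambda>z. real m * z"] x
    by (simp add: algebra_simps x_def)
  then have eq: "mills (Suc m) m = mills m m + 1 / x"
    using assms by simp
  have "1 / sqrt (x + 1) * (1 + 1 / (2 * (x + 1))) \<le> 1 / sqrt x"
  proof (rule power2_le_imp_le)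
    have "(1 / sqrt (x + 1) * (1 + 1 / (2 * (x + 1))))\<^sup>2 = 1 / (x + 1) * (1 + 1 / (2 * (x + 1)))\<^sup>2"
      using x by (simp add: power_mult_distrib power_divide)
    also have "\<dots> \<le> 1 / x"
      using x by (simp add: divide_simps power2_eq_square) (simp add: algebra_simps)
    also have "\<dots> = (1 / sqrt x)\<^sup>2" using x by (simp add: power_divide)
    finally show "(1 / sqrt (x + 1) * (1 + 1 / (2 * (x + 1))))\<^sup>2 \<le> (1 / sqrt x)\<^sup>2" .
  qed (use x in simp)
  then have "sqrt (157 / 100) * (1 / sqrt (x + 1) * (1 + 1 / (2 * (x + 1))))
      \<le> sqrt (157 / 100) * (1 / sqrt x)"
    by (rule mult_left_mono) simp
  also have "\<dots> \<le> mills m m" using mills_diag_ge[OF assms] by (simp add: x_def)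
  finally have "sqrt (157 / 100) / sqrt (x + 1) * (1 + 1 / (2 * (x + 1))) \<le> mills m m"
    by simp
  moreover have "1 / (x + 1) + 1 / (3 * (x + 1)\<^sup>2) \<le> 1 / x"
    using x by (simp add: divide_simps power2_eq_square) (simp add: algebra_simps)
  ultimately show ?thesis
    using eq by (simp add: mills_minorant_def x_def algebra_simps)
qed

text \<open>For \<open>n = a + b + 1\<close> and \<open>s = a - b - 1\<close> the factors are
  \<open>2 * b\<close> and \<open>2 * a\<close>, and \<open>mills_Suc\<close>, doubled, is this
  relation with equality. Hence the bound passes from \<open>s\<close> to \<open>s + 2\<close>
  within a fixed toss.\<close>

lemma mills_minorant_step:
  assumes n: "0 < n" and s: "0 \<le> s"
  shows "(n - s - 2) * mills_minorant n (s + 2) \<le> (n + s) * mills_minorant n s + 2"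
proof -
  define k where "k = sqrt (157 / 100) / sqrt n"
  have k: "0 \<le> k" using n by (simp add: k_def)
  have even_part: "(n - s - 2) * (1 + (s + 2)\<^sup>2 / (2 * n)) \<le> (n + s) * (1 + s\<^sup>2 / (2 * n))"
  proof -
    have "(n + s) * (1 + s\<^sup>2 / (2 * n)) - (n - s - 2) * (1 + (s + 2)\<^sup>2 / (2 * n))
      = ((s + 2) ^ 3 + s ^ 3) / (2 * n)"
      using n by (simp add: divide_simps power2_eq_square power3_eq_cube) (simp add: algebra_simps)
    moreover have "0 \<le> ((s + 2) ^ 3 + s ^ 3) / (2 * n)" using n s by simp
    ultimately show ?thesis by linarith
  qed
  have odd_part: "(n - s - 2) * ((s + 2) / n + (s + 2) ^ 3 / (3 * n\<^sup>2))
      \<le> (n + s) * (s / n + s ^ 3 / (3 * n\<^sup>2)) + 2"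
  proof -
    have "(n + s) * (s / n + s ^ 3 / (3 * n\<^sup>2)) + 2
        - (n - s - 2) * ((s + 2) / n + (s + 2) ^ 3 / (3 * n\<^sup>2))
      = ((s + 2) ^ 4 + s ^ 4 + 4 * n) / (3 * n\<^sup>2)"
      using n by (simp add: divide_simps power2_eq_square power3_eq_cube power4_eq_xxxx)
        (simp add: algebra_simps)
    moreover have "0 \<le> ((s + 2) ^ 4 + s ^ 4 + 4 * n) / (3 * n\<^sup>2)" using n s by simp
    ultimately show ?thesis by linarith
  qed
  show ?thesis
    using mult_left_mono[OF even_part k] odd_part
    unfolding mills_minorant_def k_def[symmetric] by (simp add: algebra_simps)
qed

text \<open>Induction outward from the diagonal, \<open>e\<close> being the parity of the lead.
  Passing from \<open>(b, j + 1)\<close> to \<open>(b + 1, j)\<close> keeps the toss fixed.\<close>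

lemma mills_ge_minorant:
  assumes "18 \<le> 2 * b + e + 2 * j" "0 < b" "e \<le> 1"
  shows "mills_minorant (real (2 * b + e + 2 * j)) (real (e + 2 * j)) \<le> mills (b + e + 2 * j) b"
  using assms
proof (induction j arbitrary: b)
  case 0
  then consider "e = 0" "9 \<le> b" | "e = 1" "9 \<le> b" by linarith
  then show ?case
  proof cases
    case 1
    then show ?thesis using mills_diag_ge[of b] by (simp add: mills_minorant_def)
  next
    case 2
    then show ?thesis using mills_near_diag_ge[of b] by simp
  qed
next
  case (Suc j)
  let ?n = "real (2 * b + e + 2 * Suc j)" and ?s = "real (e + 2 * j)"
  have IH: "mills_minorant ?n ?s \<le> mills (Suc b + e + 2 * j) (Suc b)"
    using Suc.IH[of "Suc b"] Suc.prems by (simp add: algebra_simps)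
  have "real b * mills (Suc (Suc b + e + 2 * j)) b
      = real (Suc b + e + 2 * j) * mills (Suc b + e + 2 * j) (Suc b) + 1"
    using mills_Suc Suc.prems by blast
  moreover have "real (Suc b + e + 2 * j) * mills_minorant ?n ?s
      \<le> real (Suc b + e + 2 * j) * mills (Suc b + e + 2 * j) (Suc b)"
    using IH by (rule mult_left_mono) simp
  moreover have "2 * real b * mills_minorant ?n (?s + 2)
      \<le> 2 * real (Suc b + e + 2 * j) * mills_minorant ?n ?s + 2"
    using mills_minorant_step[of ?n ?s] Suc.prems by (simp add: algebra_simps)
  ultimately have "real b * mills_minorant ?n (?s + 2) \<le> real b * mills (Suc (Suc b + e + 2 * j)) b"
    by linarith
  then have "mills_minorant ?n (?s + 2) \<le> mills (Suc (Suc b + e + 2 * j)) b"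
    using Suc.prems by simp
  then show ?case by (simp add: algebra_simps)
qed

text \<open>After scaling, only \<open>y = s / sqrt n\<close> remains. For the full integral the
  least possible factor is \<open>1 - \<alpha>\<^sup>2\<close>, about 0.295, with Shepp's constant
  0.84 as \<open>\<alpha>\<close>; \<open>5 / 16\<close> leaves room for truncation and
  rounding.\<close>

lemma minorant_dominates:
  assumes "0 < n" "0 \<le> s"
  shows "s / n \<le> 5 / 16 * mills_minorant n s"
proof -
  define y where "y = s / sqrt n"
  define k :: real where "k = sqrt (157 / 100)"
  have y: "0 \<le> y" using assms by (simp add: y_def)
  have k: "3758 / 3000 \<le> k" unfolding k_def by (rule real_le_rsqrt) (simp add: power2_eq_square)
  have s: "s = y * sqrt n" using assms by (simp add: y_def)
  have n: "n = sqrt n * sqrt n" using assms by simp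
  have q: "sqrt n > 0" using assms by simp
  \<comment> \<open>The cubic has minimum about \<open>0.036\<close>, near \<open>y = 0.98\<close>.\<close>
  have "y ^ 3 + 1879 / 1000 * y\<^sup>2 - 66 / 10 * y + 3758 / 1000
     = (y - 98 / 100)\<^sup>2 * (y + 382 / 100) + 19 / 1000 * (y - 193 / 100)\<^sup>2
       + (3758 / 1000 - 3668728 / 1000000 - 19 / 1000 * (193 / 100)\<^sup>2)
       + (- 66 / 10 + 65268 / 10000 + 38 / 1000 * (193 / 100)) * y"
    by (simp add: power2_eq_square power3_eq_cube field_simps)
  moreover have "0 \<le> (y - 98 / 100)\<^sup>2 * (y + 382 / 100)" using y by simp
  moreover have "0 \<le> 19 / 1000 * (y - 193 / 100)\<^sup>2" by simp
  ultimately have cubic: "0 \<le> y ^ 3 + 1879 / 1000 * y\<^sup>2 - 66 / 10 * y + 3758 / 1000"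
    using y by (simp add: power2_eq_square)
  have "3758 / 3000 * (1 + y\<^sup>2 / 2) \<le> k * (1 + y\<^sup>2 / 2)"
    using k by (rule mult_right_mono) simp
  \<comment> \<open>With \<open>3758 / 3000\<close> in place of \<open>k\<close>, the right side
    minus the left is \<open>5 / 48\<close> times the cubic.\<close>
  then have main: "y \<le> 5 / 16 * (k * (1 + y\<^sup>2 / 2) + y + y ^ 3 / 3)"
    using cubic by (simp add: algebra_simps)
  have "s / n = y / sqrt n" using q unfolding s by (subst n) (simp add: field_simps)
  moreover have "mills_minorant n s = (k * (1 + y\<^sup>2 / 2) + y + y ^ 3 / 3) / sqrt n"
  proof -
    have "s\<^sup>2 / (2 * n) = y\<^sup>2 / 2"
      using assms by (simp add: y_def power_divide)
    moreover have "s ^ 3 / (3 * n\<^sup>2) = y ^ 3 / 3 / sqrt n"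
    proof -
      have "n\<^sup>2 = sqrt n ^ 3 * sqrt n" using n by (simp add: power2_eq_square power3_eq_cube mult.assoc del: real_sqrt_mult_self)
      then show ?thesis using q by (simp add: y_def power_divide)
    qed
    ultimately show ?thesis using \<open>s / n = y / sqrt n\<close>
      by (simp add: mills_minorant_def k_def add_divide_distrib)
  qed
  ultimately show ?thesis using divide_right_mono[OF main, of "sqrt n"] q by simp
qed

text \<open>Since \<open>a / n = 1 / 2 + (a - b) / (2 * n)\<close>, this amounts to domination of
  the payoff by \<open>1 / 2 + 5 / 32 * mills a b\<close>.\<close>

lemma mills_dominates:
  assumes "18 \<le> a + b" "0 < b"
  shows "(real a - real b) / real (a + b) \<le> 5 / 16 * mills a b"
proof (cases "b \<le> a")
  case True
  define e where "e = (a - b) mod 2"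
  define j where "j = (a - b) div 2"
  have a: "a = b + e + 2 * j" and e: "e \<le> 1" using True by (auto simp: e_def j_def)
  have "(real a - real b) / real (a + b) = real (e + 2 * j) / real (2 * b + e + 2 * j)"
    by (simp add: a)
  also have "\<dots> \<le> 5 / 16 * mills_minorant (real (2 * b + e + 2 * j)) (real (e + 2 * j))"
    by (rule minorant_dominates) (use assms in auto)
  also have "\<dots> \<le> 5 / 16 * mills a b"
    using mills_ge_minorant[of b e j] assms e by (simp add: a)
  finally show ?thesis .
next
  case False
  then have "(real a - real b) / real (a + b) \<le> 0" by (simp add: divide_nonpos_nonneg)
  then show ?thesis using mills_nonneg[of a b] by linarith
qed

text \<open>
  Having \<open>k\<close> heads fewer lowers the payoff by \<open>k / n\<close>, and \<open>k / n\<close> decreases along the game.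
\<close>

lemma majorized_mills:
  assumes "18 \<le> a + b" "k < a" "0 < b"
  shows "majorized a b (1 / 2 + 5 / 32 * mills (a - k) (b + k) + real k / real (a + b))"
proof -
  define F where "F x y = 1 / 2 + 5 / 32 * mills (x - k) (y + k) + real k / real (x + y)" for x y
  have "real x / real (x + y) \<le> F x y \<and> (F (Suc x) y + F x (Suc y)) / 2 \<le> F x y"
    if xy: "x \<ge> a" "y \<ge> b" for x y
  proof
    have p: "0 < real (x + y)" using xy assms by simp
    have "(real (x - k) - real (y + k)) / real (x + y) \<le> 5 / 16 * mills (x - k) (y + k)"
      using mills_dominates[of "x - k" "y + k"] xy assms by simp
    moreover have "(real (x - k) - real (y + k)) / real (x + y)
        = 2 * (real x / real (x + y)) - 1 - 2 * (real k / real (x + y))"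
    proof -
      have "real (x - k) - real (y + k) = 2 * real x - real (x + y) - 2 * real k"
        using xy assms by (simp add: of_nat_diff)
      then show ?thesis using p by (simp only: diff_divide_distrib) simp
    qed
    ultimately show "real x / real (x + y) \<le> F x y" unfolding F_def by linarith
    have "mills (Suc x - k) (y + k) + mills (x - k) (Suc y + k) = 2 * mills (x - k) (y + k)"
      using mills_harmonic[of "x - k" "y + k"] xy assms by (simp add: Suc_diff_le)
    moreover have "real k / real (Suc (x + y)) \<le> real k / real (x + y)"
      using p by (simp add: frac_le)
    ultimately show "(F (Suc x) y + F x (Suc y)) / 2 \<le> F x y"
      by (simp add: F_def)
  qed
  then have "majorant_from a b F" by (simp add: majorant_from_def)
  then show ?thesis unfolding majorized_def F_def by blast
qed

section \<open>Backward induction\<close>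

text \<open>The list holds bounds at toss \<open>n + 1\<close> for \<open>a, a + 1, \<dots>\<close>
  heads: \<open>v\<close> is the bound after tails, \<open>w\<close> after heads. The result, one
  entry shorter, belongs to toss \<open>n\<close>.\<close>

fun backward :: "nat \<Rightarrow> nat \<Rightarrow> real list \<Rightarrow> real list" where
  "backward a n (v # w # vs) = max (real a / real n) ((v + w) / 2) # backward (Suc a) n (w # vs)"
| "backward a n vs = []"

fun level_majorized :: "nat \<Rightarrow> nat \<Rightarrow> real list \<Rightarrow> bool" where
  "level_majorized a n [] \<longleftrightarrow> True"
| "level_majorized a n (v # vs) \<longleftrightarrow>
     a \<le> n \<and> majorized a (n - a) v \<and> level_majorized (Suc a) n vs"

lemma level_majorized_backward:
  assumes "level_majorized a (Suc n) vs"
  shows "level_majorized a n (backward a n vs)"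
  using assms
proof (induction a n vs rule: backward.induct)
  case (1 a n v w vs)
  then have a: "a \<le> n" and tails: "majorized a (Suc (n - a)) v" and heads: "majorized (Suc a) (n - a) w"
    by (auto simp: Suc_diff_le)
  have "majorized a (n - a) (max (real a / real n) ((v + w) / 2))"
    by (rule majorized_step[OF heads tails]) (use a in \<open>auto simp: add.commute\<close>)
  then show ?case using 1 a by simp
qed auto

text \<open>\<open>foldr\<close> applies the last index first, so the tosses run downwards from
  \<open>n + k - 1\<close> to \<open>n\<close>.\<close>

lemma level_majorized_foldr:
  assumes "level_majorized a (n + k) vs"
  shows "level_majorized a n (foldr (backward a) [n..<n + k] vs)"
  using assms
proof (induction k arbitrary: n)
  case (Suc k)
  then show ?case
    using level_majorized_backward[OF Suc.IH[of "Suc n"]] by (simp add: upt_conv_Cons del: upt_Suc)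
qed simp

text \<open>
  Position \<open>(12, 8)\<close> is the one at toss 20 closest to Shepp's boundary \<open>a - b = 0.84 * sqrt n\<close>; beyond
  it \<open>mills\<close> is a poor bound and the translated one is used.
\<close>

definition leaf_bound :: "nat \<Rightarrow> real" where
  "leaf_bound a = 1 / 2 + 5 / 32 * mills (min a 12) (20 - min a 12) + real (a - 12) / 20"

lemma majorized_leaf:
  assumes "0 < a" "a < 20"
  shows "majorized a (20 - a) (leaf_bound a)"
proof -
  have "a - (a - 12) = min a 12" "20 - a + (a - 12) = 20 - min a 12" using assms by auto
  then show ?thesis
    using majorized_mills[of a "20 - a" "a - 12"] assms by (simp add: leaf_bound_def)
qed

lemma level_majorized_map_upt:
  assumes "\<And>a. i \<le> a \<Longrightarrow> a < j \<Longrightarrow> a \<le> n \<and> majorized a (n - a) (f a)"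
  shows "level_majorized i n (map f [i..<j])"
  using assms
proof (induction "j - i" arbitrary: i)
  case (Suc d)
  then have "level_majorized (Suc i) n (map f [Suc i..<j])" by simp
  then show ?case using Suc by (simp add: upt_conv_Cons)
qed simp

lemma mills_numeral:
  "mills (numeral k) b = (real (pred_numeral k) * mills (pred_numeral k) (Suc b) + 1) / real b"
  by (simp add: numeral_eq_Suc mills.simps)

text \<open>From \<open>(5, 3)\<close>, twelve flips lead to 5 to 17 heads at toss 20. Exact
  rational evaluation ends in the stopping payoff as the maximum.\<close>

lemma backward_leaf_bounds:
  "foldr (backward 5) [8..<8 + 12] (map leaf_bound [5..<18]) = [5 / 8]"
  by (simp add: upt_rec_numeral leaf_bound_def mills_numeral mills.simps max_def)

lemma majorized_5_3: "majorized 5 3 (5 / 8)"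
proof -
  have "level_majorized 5 (8 + 12) (map leaf_bound [5..<18])"
    by (rule level_majorized_map_upt) (simp add: majorized_leaf)
  from level_majorized_foldr[OF this] have "level_majorized 5 8 [5 / 8]"
    unfolding backward_leaf_bounds .
  then show ?thesis by simp
qed

section \<open>Optional stopping\<close>

lemma enat_less_iff_Suc: "enat t < u \<longleftrightarrow> u = enat (Suc t) \<or> enat (Suc t) < u"
  by (metis Suc_ile_eq order_le_less)

lemma enat_eq_Suc_iff: "u = enat (Suc t) \<longleftrightarrow> u \<le> enat (Suc t) \<and> \<not> u \<le> enat t"
  by (cases u) (simp_all only: enat_ord_simps enat.inject, auto)

section \<open>Flips, heads counts and their filtration\<close>

context fair_coin_flips
begin

lemma X_measurable [measurable]: "X i \<in> borel_measurable M"
  using indep_flips by (auto simp: indep_vars_def)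

lemma AE_flip: "AE \<omega> in M. X i \<omega> = 0 \<or> X i \<omega> = 1"
proof -
  have "prob ({\<omega> \<in> space M. X i \<omega> = 1} \<union> {\<omega> \<in> space M. X i \<omega> = 0}) = 1 / 2 + 1 / 2"
    by (subst finite_measure_Union) (auto simp: prob_heads prob_tails)
  also have "{\<omega> \<in> space M. X i \<omega> = 1} \<union> {\<omega> \<in> space M. X i \<omega> = 0}
      = {\<omega> \<in> space M. X i \<omega> = 0 \<or> X i \<omega> = 1}" by auto
  finally have "prob {\<omega> \<in> space M. X i \<omega> = 0 \<or> X i \<omega> = 1} = 1" by simp
  then show ?thesis by (subst (asm) prob_Collect_eq_1) auto
qed

lemma heads_count_Suc: "heads_count X (Suc t) \<omega> = heads_count X t \<omega> + X t \<omega>"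
  by (simp add: heads_count_def)

lemma AE_heads_count: "AE \<omega> in M. \<forall>t. \<exists>k\<le>t. heads_count X t \<omega> = real k"
proof -
  have "AE \<omega> in M. \<forall>i. X i \<omega> = 0 \<or> X i \<omega> = 1"
    using AE_flip by (simp add: AE_all_countable)
  then show ?thesis
  proof (rule AE_mp, intro AE_I2 impI allI)
    fix \<omega> t assume *: "\<forall>i. X i \<omega> = 0 \<or> X i \<omega> = 1"
    show "\<exists>k\<le>t. heads_count X t \<omega> = real k"
    proof (induction t)
      case (Suc t)
      then obtain k where k: "k \<le> t" "heads_count X t \<omega> = real k" by auto
      then have "heads_count X (Suc t) \<omega> = (if X t \<omega> = 0 then real k else real (Suc k))"
        using *[rule_format, of t] by (auto simp: heads_count_Suc)
      then show ?case using k by (metis Suc_le_mono le_SucI)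
    qed (simp add: heads_count_def)
  qed
qed

lemma space_flip_filtration [simp]: "space (flip_filtration M X t) = space M"
  by (auto simp: flip_filtration_def intro!: space_measure_of)

lemma sets_flip_filtration:
  "sets (flip_filtration M X t) =
     sigma_sets (space M) {X i -` B \<inter> space M | i B. enat i < t \<and> B \<in> sets borel}"
  unfolding flip_filtration_def by (rule sets_measure_of) auto

lemma subalgebra_flip_filtration: "subalgebra M (flip_filtration M X t)"
  unfolding subalgebra_def sets_flip_filtration
  by (auto intro!: sets.sigma_sets_subset measurable_sets[OF X_measurable])

lemma flip_filtration_events: "A \<in> sets (flip_filtration M X t) \<Longrightarrow> A \<in> events"
  using subalgebra_flip_filtration by (auto simp: subalgebra_def)

lemma heads_count_adapted: "heads_count X t \<in> borel_measurable (flip_filtration M X (enat t))"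
proof -
  have "X i \<in> borel_measurable (flip_filtration M X (enat t))" if "i < t" for i
    using that by (auto simp: measurable_def sets_flip_filtration)
  then show ?thesis unfolding heads_count_def[abs_def] by (intro borel_measurable_sum) auto
qed

lemma heads_count_measurable [measurable]: "heads_count X t \<in> borel_measurable M"
  unfolding heads_count_def[abs_def] by measurable

text \<open>The past and flip \<open>t\<close> are generated by disjoint blocks of independent
  flips.\<close>

lemma prob_past_inter_flip:
  assumes A: "A \<in> sets (flip_filtration M X (enat t))" and x: "x = 0 \<or> x = 1"
  shows "prob {\<omega> \<in> A. X t \<omega> = x} = prob A / 2"
proof -
  let ?E = "\<lambda>i. {X i -` B \<inter> space M | B. B \<in> sets borel}"
  let ?I = "case_bool {..<t} {t}"
  have "indep_sets ?E (\<Union>j\<in>UNIV. ?I j)"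
    using indep_flips by (auto simp: indep_vars_def2 intro: indep_sets_mono_index)
  moreover have "Int_stable (?E i)" for i
  proof (rule Int_stableI)
    fix C D assume "C \<in> ?E i" "D \<in> ?E i"
    then obtain B B' where B: "B \<in> sets borel" "B' \<in> sets borel"
      "C = X i -` B \<inter> space M" "D = X i -` B' \<inter> space M" by auto
    then have "C \<inter> D = X i -` (B \<inter> B') \<inter> space M" by auto
    then show "C \<inter> D \<in> ?E i" using B by blast
  qed
  moreover have "disjoint_family_on ?I UNIV"
    by (auto simp: disjoint_family_on_def split: bool.splits)
  ultimately have "indep_sets (\<lambda>j. sigma_sets (space M) (\<Union>i\<in>?I j. ?E i)) UNIV"
    by (intro indep_sets_collect_sigma) auto
  moreover have "A \<in> sigma_sets (space M) (\<Union>i\<in>?I True. ?E i)"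
  proof -
    have "(\<Union>i\<in>?I True. ?E i) = {X i -` B \<inter> space M | i B. enat i < enat t \<and> B \<in> sets borel}"
      by auto
    then show ?thesis using A by (simp add: sets_flip_filtration)
  qed
  moreover have "{\<omega> \<in> space M. X t \<omega> = x} \<in> sigma_sets (space M) (\<Union>i\<in>?I False. ?E i)"
    by (rule sigma_sets.Basic) (auto intro!: exI[of _ "{x}"])
  ultimately have "prob (\<Inter>j\<in>UNIV. case_bool A {\<omega> \<in> space M. X t \<omega> = x} j)
      = (\<Prod>j\<in>UNIV. prob (case_bool A {\<omega> \<in> space M. X t \<omega> = x} j))"
    by (intro indep_setsD) (auto split: bool.splits)
  then have "prob (A \<inter> {\<omega> \<in> space M. X t \<omega> = x}) = prob A * prob {\<omega> \<in> space M. X t \<omega> = x}"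
    by (simp add: UNIV_bool Int_commute mult.commute)
  moreover have "A \<inter> {\<omega> \<in> space M. X t \<omega> = x} = {\<omega> \<in> A. X t \<omega> = x}"
    using sets.sets_into_space[OF flip_filtration_events[OF A]] by auto
  ultimately show ?thesis using x prob_heads prob_tails by auto
qed

section \<open>Occupation probabilities under a fixed stopping rule\<close>

context
  fixes T :: "'a \<Rightarrow> enat"
  assumes T: "T \<in> stopping_rules M X"
begin

text \<open>The count is a real number so that the predecessor \<open>x - 1\<close> makes sense for
  every \<open>x\<close>.\<close>

definition running :: "nat \<Rightarrow> real \<Rightarrow> 'a set" where
  "running t x = {\<omega> \<in> space M. enat t < T \<omega> \<and> heads_count X t \<omega> = x}"

definition stopped :: "nat \<Rightarrow> real \<Rightarrow> 'a set" where
  "stopped t x = {\<omega> \<in> space M. T \<omega> = enat t \<and> heads_count X t \<omega> = x}"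

lemma T_le_adapted: "{\<omega> \<in> space M. T \<omega> \<le> enat t} \<in> sets (flip_filtration M X (enat t))"
proof -
  have "Measurable.pred (flip_filtration M X (enat t)) (\<lambda>\<omega>. T \<omega> \<le> enat t)"
    using T by (auto simp: stopping_rules_def stopping_time_def)
  from predE[OF this] show ?thesis by simp
qed

lemma running_adapted: "running t x \<in> sets (flip_filtration M X (enat t))"
proof -
  let ?F = "flip_filtration M X (enat t)"
  have "heads_count X t -` {x} \<inter> space ?F \<in> sets ?F"
    by (rule measurable_sets[OF heads_count_adapted]) simp
  then have "(heads_count X t -` {x} \<inter> space ?F) - {\<omega> \<in> space M. T \<omega> \<le> enat t} \<in> sets ?F"
    using T_le_adapted by (rule sets.Diff)
  also have "(heads_count X t -` {x} \<inter> space ?F) - {\<omega> \<in> space M. T \<omega> \<le> enat t} = running t x"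
    by (auto simp: running_def)
  finally show ?thesis .
qed

lemma running_events [measurable]: "running t x \<in> events"
  by (rule flip_filtration_events[OF running_adapted])

lemma T_le_events [measurable]: "{\<omega> \<in> space M. T \<omega> \<le> enat t} \<in> events"
  by (rule flip_filtration_events[OF T_le_adapted])

lemma T_eq_events [measurable]: "{\<omega> \<in> space M. T \<omega> = enat t} \<in> events"
proof (cases t)
  case 0
  then show ?thesis using T_le_events[of 0] by (simp add: zero_enat_def[symmetric])
next
  case (Suc u)
  have "{\<omega> \<in> space M. T \<omega> \<le> enat t} - {\<omega> \<in> space M. T \<omega> \<le> enat u} \<in> events"
    by (intro sets.Diff T_le_events)
  also have "{\<omega> \<in> space M. T \<omega> \<le> enat t} - {\<omega> \<in> space M. T \<omega> \<le> enat u} = {\<omega> \<in> space M. T \<omega> = enat t}"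
    unfolding Suc enat_eq_Suc_iff by blast
  finally show ?thesis .
qed

lemma stopped_events [measurable]: "stopped t x \<in> events"
proof -
  have "stopped t x = {\<omega> \<in> space M. T \<omega> = enat t} \<inter> (heads_count X t -` {x} \<inter> space M)"
    by (auto simp: stopped_def)
  then show ?thesis using T_eq_events measurable_sets[OF heads_count_measurable, of "{x}"] by auto
qed

lemma stopped_Int_running: "stopped t x \<inter> running t y = {}"
  by (auto simp: stopped_def running_def)

lemma running_flip_events: "{\<omega> \<in> running t x. X t \<omega> = y} \<in> events"
proof -
  have "{\<omega> \<in> running t x. X t \<omega> = y} = running t x \<inter> (X t -` {y} \<inter> space M)"
    by (auto simp: running_def)
  then show ?thesis using running_events measurable_sets[OF X_measurable, of "{y}"] by auto
qed

text \<open>This removes the boundary terms with \<open>-1\<close> or \<open>t + 1\<close> heads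
  after \<open>t\<close> flips.\<close>

lemma prob_running_outside:
  assumes "\<And>k. k \<le> t \<Longrightarrow> x \<noteq> real k"
  shows "prob (running t x) = 0"
proof -
  have "AE \<omega> in M. \<omega> \<notin> running t x"
    using AE_heads_count by eventually_elim (use assms in \<open>auto simp: running_def\<close>)
  then show ?thesis using prob_eq_0[OF running_events] by simp
qed

text \<open>Both sides measure the event that flip \<open>t\<close> is made and brings the count to
  \<open>x\<close>: tails from \<open>x\<close> or heads from \<open>x - 1\<close>.\<close>

lemma prob_reach_Suc:
  "prob (stopped (Suc t) x) + prob (running (Suc t) x)
     = (prob (running t x) + prob (running t (x - 1))) / 2"
proof -
  have "prob (stopped (Suc t) x) + prob (running (Suc t) x)
      = prob (stopped (Suc t) x \<union> running (Suc t) x)"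
    by (simp add: finite_measure_Union stopped_events running_events stopped_Int_running)
  also have "\<dots> = prob ({\<omega> \<in> running t x. X t \<omega> = 0} \<union> {\<omega> \<in> running t (x - 1). X t \<omega> = 1})"
  proof (rule measure_eq_AE)
    show "AE \<omega> in M. \<omega> \<in> stopped (Suc t) x \<union> running (Suc t) x \<longleftrightarrow>
        \<omega> \<in> {\<omega> \<in> running t x. X t \<omega> = 0} \<union> {\<omega> \<in> running t (x - 1). X t \<omega> = 1}"
      using AE_flip[of t]
    proof eventually_elim
      case (elim \<omega>)
      have "\<omega> \<in> stopped (Suc t) x \<union> running (Suc t) x \<longleftrightarrow>
          \<omega> \<in> space M \<and> enat t < T \<omega> \<and> heads_count X (Suc t) \<omega> = x"
        unfolding stopped_def running_def enat_less_iff_Suc[of t] by blast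
      moreover have "heads_count X (Suc t) \<omega> = x \<longleftrightarrow>
          X t \<omega> = 0 \<and> heads_count X t \<omega> = x \<or> X t \<omega> = 1 \<and> heads_count X t \<omega> = x - 1"
        using elim unfolding heads_count_Suc by linarith
      ultimately show ?case unfolding running_def by blast
    qed
  qed (intro sets.Un stopped_events running_events running_flip_events)+
  also have "\<dots> = prob {\<omega> \<in> running t x. X t \<omega> = 0} + prob {\<omega> \<in> running t (x - 1). X t \<omega> = 1}"
    by (intro finite_measure_Union running_flip_events) auto
  finally show ?thesis using prob_past_inter_flip[OF running_adapted] by simp
qed

text \<open>The left side is the expectation of \<open>F\<close> at the position reached at time
  \<open>min T t\<close>; it does not increase with \<open>t\<close>, as \<open>F\<close> is
  excessive.\<close>

lemma stopped_sum_le: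
  assumes F: "majorant_from a b F"
  shows "(\<Sum>u\<le>t. \<Sum>k\<le>u. prob (stopped u (real k)) * F (a + k) (b + (u - k)))
     + (\<Sum>k\<le>t. prob (running t (real k)) * F (a + k) (b + (t - k))) \<le> F a b"
proof (induction t)
  case 0
  have "stopped 0 0 \<union> running 0 0 = space M"
    by (auto simp: stopped_def running_def heads_count_def zero_enat_def[symmetric])
  then have "prob (stopped 0 0) + prob (running 0 0) = 1"
    using finite_measure_Union[of "stopped 0 0" "running 0 0"] stopped_Int_running stopped_events running_events
    by (simp add: prob_space)
  then have "(prob (stopped 0 0) + prob (running 0 0)) * F a b = F a b" by simp
  then show ?case by (simp add: distrib_right)
next
  case (Suc t)
  define f where "f k = F (a + k) (b + (Suc t - k))" for k
  have "(\<Sum>k\<le>Suc t. prob (stopped (Suc t) (real k)) * f k) + (\<Sum>k\<le>Suc t. prob (running (Suc t) (real k)) * f k)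
      = (\<Sum>k\<le>Suc t. (prob (running t (real k)) + prob (running t (real k - 1))) / 2 * f k)"
    by (simp only: sum.distrib[symmetric] distrib_right[symmetric] prob_reach_Suc)
  also have "\<dots> = ((\<Sum>k\<le>Suc t. prob (running t (real k)) * f k)
      + (\<Sum>k\<le>Suc t. prob (running t (real k - 1)) * f k)) / 2"
    by (simp only: sum.distrib[symmetric] sum_divide_distrib)
       (simp add: algebra_simps add_divide_distrib)
  also have "(\<Sum>k\<le>Suc t. prob (running t (real k)) * f k) = (\<Sum>k\<le>t. prob (running t (real k)) * f k)"
    using prob_running_outside[of t "real (Suc t)"] by simp
  also have "(\<Sum>k\<le>Suc t. prob (running t (real k - 1)) * f k) = (\<Sum>k\<le>t. prob (running t (real k)) * f (Suc k))"
    using prob_running_outside[of t "-1"] by (simp add: sum.atMost_Suc_shift del: sum.atMost_Suc)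
  also have "((\<Sum>k\<le>t. prob (running t (real k)) * f k) + (\<Sum>k\<le>t. prob (running t (real k)) * f (Suc k))) / 2
      = (\<Sum>k\<le>t. prob (running t (real k)) * ((f k + f (Suc k)) / 2))"
    by (simp only: sum.distrib[symmetric] sum_divide_distrib)
       (simp add: algebra_simps add_divide_distrib)
  \<comment> \<open>\<open>f k\<close> and \<open>f (Suc k)\<close> are the values of
    \<open>F\<close> at the two successors of the position with \<open>k\<close> new heads after
    \<open>t\<close> flips.\<close>
  also have "\<dots> \<le> (\<Sum>k\<le>t. prob (running t (real k)) * F (a + k) (b + (t - k)))"
  proof (intro sum_mono mult_left_mono)
    fix k assume "k \<in> {..t}"
    moreover have "F (Suc (a + k)) (b + (t - k)) + F (a + k) (Suc (b + (t - k)))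
        \<le> 2 * F (a + k) (b + (t - k))"
      by (rule majorant_fromD(2)[OF F]) auto
    ultimately show "(f k + f (Suc k)) / 2 \<le> F (a + k) (b + (t - k))"
      by (simp add: f_def Suc_diff_le add.commute)
  qed simp
  finally show ?case using Suc.IH by (simp add: f_def)
qed

text \<open>The payoff restricted to \<open>T \<le> t\<close> is bounded by the stopped part of the
  preceding sum; then \<open>t\<close> tends to infinity.\<close>

lemma expected_payoff_le_majorant:
  assumes F: "majorant_from a b F"
  shows "(\<integral>\<omega>. payoff X a (a + b) T \<omega> \<partial>M) \<le> F a b"
proof (cases "integrable M (payoff X a (a + b) T)")
  \<comment> \<open>The integral of a non-integrable function is 0 by convention, and
    \<open>F\<close> is nonnegative.\<close>
  case False
  then show ?thesis using majorant_fromD(3)[OF F] by (simp add: not_integrable_integral_eq)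
next
  case True
  let ?p = "payoff X a (a + b) T"
  let ?A = "\<lambda>t. {\<omega> \<in> space M. T \<omega> \<le> enat t}"
  have "(\<integral>\<omega>. ?p \<omega> * indicator (?A t) \<omega> \<partial>M) \<le> F a b" for t
  proof -
    \<comment> \<open>Almost surely, \<open>?g\<close> is \<open>F\<close> at the stopping position
      if \<open>T \<le> t\<close>, and 0 otherwise.\<close>
    let ?g = "\<lambda>\<omega>. \<Sum>u\<le>t. \<Sum>k\<le>u. indicator (stopped u (real k)) \<omega> * F (a + k) (b + (u - k))"
    have "(\<integral>\<omega>. ?p \<omega> * indicator (?A t) \<omega> \<partial>M) \<le> (\<integral>\<omega>. ?g \<omega> \<partial>M)"
    proof (rule integral_mono_AE)
      show "integrable M (\<lambda>\<omega>. ?p \<omega> * indicator (?A t) \<omega>)"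
        using True by (intro integrable_real_mult_indicator) auto
      show "integrable M ?g"
        by (intro Bochner_Integration.integrable_sum integrable_mult_left) (auto simp: less_top[symmetric])
      show "AE \<omega> in M. ?p \<omega> * indicator (?A t) \<omega> \<le> ?g \<omega>"
        using AE_heads_count AE_space
      proof eventually_elim
        case (elim \<omega>)
        have nonneg: "0 \<le> indicator (stopped u (real k)) \<omega> * F (a + k) (b + (u - k))" for u k
          using majorant_fromD(3)[OF F] by simp
        show ?case
        proof (cases "\<omega> \<in> ?A t")
          case False
          then have "?p \<omega> * indicator (?A t) \<omega> = 0" by simp
          also have "0 \<le> ?g \<omega>" by (intro sum_nonneg nonneg)
          finally show ?thesis .
        next
          case True
          then obtain u where u: "T \<omega> = enat u" "u \<le> t" by (cases "T \<omega>") auto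
          obtain k where k: "k \<le> u" "heads_count X u \<omega> = real k" using elim by blast
          have "?p \<omega> * indicator (?A t) \<omega> = real (a + k) / real ((a + k) + (b + (u - k)))"
            using True u k by (simp add: payoff_def of_nat_diff algebra_simps)
          also have "\<dots> \<le> F (a + k) (b + (u - k))"
            by (rule majorant_fromD(1)[OF F]) auto
          also have "\<dots> = indicator (stopped u (real k)) \<omega> * F (a + k) (b + (u - k))"
            using u k elim by (simp add: stopped_def)
          also have "\<dots> \<le> (\<Sum>k\<le>u. indicator (stopped u (real k)) \<omega> * F (a + k) (b + (u - k)))"
            by (rule member_le_sum[OF _ nonneg]) (use k in auto)
          also have "\<dots> \<le> ?g \<omega>"
            by (rule member_le_sum[OF _ sum_nonneg[OF nonneg]]) (use u in auto)
          finally show ?thesis .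
        qed
      qed
    qed
    also have "\<dots> = (\<Sum>u\<le>t. \<Sum>k\<le>u. prob (stopped u (real k)) * F (a + k) (b + (u - k)))"
      by (simp add: Bochner_Integration.integral_sum less_top[symmetric]
          del: sum_indicator_mult sum_mult_indicator)
    also have "\<dots> \<le> F a b"
    proof -
      have "0 \<le> (\<Sum>k\<le>t. prob (running t (real k)) * F (a + k) (b + (t - k)))"
        using majorant_fromD(3)[OF F] by (intro sum_nonneg) simp
      then show ?thesis using stopped_sum_le[OF F, of t] by linarith
    qed
    finally show ?thesis .
  qed
  \<comment> \<open>Almost sure finiteness of \<open>T\<close> enters here: the truncated payoffs
    are eventually equal to the full one.\<close>
  moreover have "(\<lambda>t. \<integral>\<omega>. ?p \<omega> * indicator (?A t) \<omega> \<partial>M) \<longlonglongrightarrow> (\<integral>\<omega>. ?p \<omega> \<partial>M)"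
  proof (rule integral_dominated_convergence[where w = "\<lambda>\<omega>. \<bar>?p \<omega>\<bar>"])
    show "AE \<omega> in M. (\<lambda>t. ?p \<omega> * indicator (?A t) \<omega>) \<longlonglongrightarrow> ?p \<omega>"
    proof -
      have "AE \<omega> in M. T \<omega> \<noteq> \<infinity>" using T by (simp add: stopping_rules_def)
      with AE_space show ?thesis
      proof eventually_elim
        case (elim \<omega>)
        then obtain u where "T \<omega> = enat u" by auto
        then have "\<forall>\<^sub>F t in sequentially. ?p \<omega> * indicator (?A t) \<omega> = ?p \<omega>"
          using elim by (auto simp: eventually_sequentially indicator_def)
        then show ?case by (rule tendsto_eventually)
      qed
    qed
  qed (use True in \<open>auto intro!: integrable_abs borel_measurable_times borel_measurable_indicator
      T_le_events simp: indicator_def borel_measurable_integrable\<close>)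
  ultimately show ?thesis by (intro LIMSEQ_le_const2) auto
qed

end

text \<open>Stopping at once attains the upper bound given by the majorant; that bound also makes
  the supremum well behaved.\<close>

lemma game_value_eq_payoff:
  assumes "majorized a b (real a / real (a + b))"
  shows "game_value M X a (a + b) = real a / real (a + b)"
proof -
  let ?v = "real a / real (a + b)"
  obtain F where F: "majorant_from a b F" "F a b \<le> ?v"
    using assms by (auto simp: majorized_def)
  have upper: "(\<integral>\<omega>. payoff X a (a + b) T \<omega> \<partial>M) \<le> ?v" if "T \<in> stopping_rules M X" for T
    using expected_payoff_le_majorant[OF that F(1)] F(2) by linarith
  have stop: "(\<lambda>_. 0) \<in> stopping_rules M X"
    by (auto simp: stopping_rules_def stopping_time_def zero_enat_def)
  have "(\<integral>\<omega>. payoff X a (a + b) (\<lambda>_. 0) \<omega> \<partial>M) = ?v"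
    by (simp add: payoff_def heads_count_def prob_space zero_enat_def)
  then have "?v \<le> game_value M X a (a + b)"
    unfolding game_value_def
    using stop upper by (metis (mono_tags, lifting) bdd_aboveI2 cSUP_upper)
  moreover have "game_value M X a (a + b) \<le> ?v"
    unfolding game_value_def using stop upper by (intro cSUP_least) auto
  ultimately show ?thesis by simp
qed

end

theorem mainTheorem1:
  fixes M :: "'a measure" and X :: "nat \<Rightarrow> 'a \<Rightarrow> real"
  assumes "fair_coin_flips M X"
  shows "stopping_optimal M X 5 8 \<and> game_value M X 5 8 = 5 / 8"
proof -
  have "game_value M X 5 8 = 5 / 8"
    using fair_coin_flips.game_value_eq_payoff[OF assms, of 5 3] majorized_5_3 by simp
  then show ?thesis by (simp add: stopping_optimal_def)
qed

end
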